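(* There exists an absolute constant $a>0$ such that for all positive integers $g$ and $\Delta\ge 2$ there exists a digraph $D$ of girth at least $g$, with maximum total degree $\Delta(D)\le\Delta$, and with $\chi(D)\ge a\Delta/\log\Delta$. Moreover, for $\Delta$ sufficiently large one may take $a=\frac{1}{15}$.
   Context: Digraphs are loopless. A set $A\subseteq V(D)$ is acyclic if the induced subdigraph $D[A]$ contains no directed cycle. The chromatic number $\chi(D)$ of a digraph $D$ is the minimum integer $k$ such that $V(D)$ can be partitioned into at most $k$ acyclic sets. A cycle in $D$ means a cycle in the underlying undirected graph, and the girth of $D$ is the length of a shortest such cycle. The total degree of a vertex is the number of arcs incident to it, and $\Delta(D)$ is the maximum total degree over all vertices of $D$. $\log$ denotes the natural logarithm. *)

theory Defs
  imports
    "HOL-Analysis.Analysis"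
    "HOL-Library.Extended_Nat"
    "HOL-Library.Disjoint_Sets"
    "Graph_Theory.Digraph"
    "Graph_Theory.Arc_Walk"
    "Graph_Theory.Digraph_Component"
begin

definition acyclic_set :: "('a, 'b) pre_digraph \<Rightarrow> 'a set \<Rightarrow> bool" where
  "acyclic_set D A \<longleftrightarrow> A \<subseteq> verts D \<and> \<not> (\<exists>p. pre_digraph.cycle (D \<restriction> A) p)"

definition acyclic_colourable :: "('a, 'b) pre_digraph \<Rightarrow> nat \<Rightarrow> bool" where
  "acyclic_colourable D k \<longleftrightarrow>
     (\<exists>P. partition_on (verts D) P \<and> finite P \<and> card P \<le> k \<and> (\<forall>A\<in>P. acyclic_set D A))"

definition chromatic_number :: "('a, 'b) pre_digraph \<Rightarrow> nat" where
  "chromatic_number D = (LEAST k. acyclic_colourable D k)"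

text \<open>
  A cycle of the underlying undirected graph is given by its vertices \<open>vs\<close> and arcs \<open>es\<close> in
  cyclic order, where arcs may be traversed in either direction. Antiparallel arcs are distinct
  edges of the underlying graph, so a pair of them forms a cycle of length 2; distinctness of
  \<open>es\<close> prevents a single arc from being traversed back and forth.
\<close>

definition underlying_cycle :: "('a, 'b) pre_digraph \<Rightarrow> 'a list \<Rightarrow> 'b list \<Rightarrow> bool" where
  "underlying_cycle D vs es \<longleftrightarrow>
     es \<noteq> [] \<and> length vs = length es \<and> distinct vs \<and> distinct es \<and> set es \<subseteq> arcs D \<and>
     (\<forall>i<length es.
        {tail D (es ! i), head D (es ! i)} = {vs ! i, vs ! (Suc i mod length vs)})"

text \<open>The girth is \<open>\<infinity>\<close> if the underlying graph is a forest.\<close>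

definition girth :: "('a, 'b) pre_digraph \<Rightarrow> enat" where
  "girth D = Inf {enat (length es) | vs es. underlying_cycle D vs es}"

definition total_degree :: "('a, 'b) pre_digraph \<Rightarrow> 'a \<Rightarrow> nat" where
  "total_degree D v = card {e \<in> arcs D. tail D e = v \<or> head D e = v}"

text \<open>The value 0 is inserted only to cover the digraph without vertices.\<close>

definition max_total_degree :: "('a, 'b) pre_digraph \<Rightarrow> nat" where
  "max_total_degree D = Max (insert 0 (total_degree D ` verts D))"

end

theory Submission
  imports Defs
begin

text \<open>
  Every vertex of \<open>{..<n}\<close> chooses \<open>d \<approx> 2\<Delta>/5\<close> out-neighbours uniformly at random, that is, we average
  over all functions \<open>f : {..<n} \<times> {..<d} \<rightarrow> {..<n}\<close>, where \<open>n\<close> is huge compared to \<open>\<Delta>\<close> and \<open>g\<close>.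
  The expected number of cycles of length below \<open>g\<close> is at most \<open>\<Sum>k<g. (2d)^k\<close>, independently of \<open>n\<close>, and
  by the second moment of the in-degree only \<open>O(n/\<Delta>)\<close> vertices have total degree above \<open>\<Delta>\<close>; deleting
  all offending vertices costs a small fraction of \<open>n\<close>.

  The first and second half of a reversed topological order of an acyclic set of size \<open>2m\<close> are sets
  \<open>X\<close>, \<open>Y\<close> of size \<open>m\<close> without an arc from \<open>X\<close> to \<open>Y\<close>. The expected number of such pairs is at most
  \<open>((en/m)^2 exp (-dm/n))^m\<close>, which is at most \<open>4^(-m)\<close> once \<open>m \<ge> 2n ln d / d\<close> and \<open>ln d \<ge> e\<close>. So all acyclic
  sets have size at most about \<open>4n ln d / d\<close>, and the chromatic number is at least about
  \<open>13/16 \<cdot> d / (4 ln d)\<close>, which exceeds \<open>\<Delta> / (15 ln \<Delta>)\<close>.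
\<close>

section \<open>Digraphs of functions\<close>

text \<open>Arcs are vertex pairs, so repeated choices of an out-neighbour merge into one arc, and a
  vertex choosing itself is dropped. Every \<open>f\<close> thus gives a loopless digraph without
  parallel arcs; antiparallel arcs may occur and are handled as cycles of length 2.\<close>

definition function_digraph :: "(nat \<times> nat \<Rightarrow> nat) \<Rightarrow> nat \<Rightarrow> nat set \<Rightarrow> (nat, nat \<times> nat) pre_digraph" where
  "function_digraph f d W =
     \<lparr>verts = W, arcs = {(v, f (v, i)) | v i. i < d \<and> v \<in> W \<and> f (v, i) \<in> W \<and> f (v, i) \<noteq> v},
      tail = fst, head = snd\<rparr>"

lemma function_digraph_simps [simp]:
  "verts (function_digraph f d W) = W"
  "tail (function_digraph f d W) = fst"
  "head (function_digraph f d W) = snd"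
  by (simp_all add: function_digraph_def)

lemma mem_arcs_function_digraph:
  "e \<in> arcs (function_digraph f d W) \<longleftrightarrow>
     fst e \<in> W \<and> snd e \<in> W \<and> fst e \<noteq> snd e \<and> (\<exists>i<d. snd e = f (fst e, i))"
  by (cases e) (auto simp: function_digraph_def)

lemma digraph_function_digraph:
  assumes "finite W"
  shows "digraph (function_digraph f d W)"
proof
  have "arcs (function_digraph f d W) \<subseteq> W \<times> W"
    by (auto simp: function_digraph_def)
  thus "finite (arcs (function_digraph f d W))"
    using assms finite_subset by blast
qed (auto simp: assms mem_arcs_function_digraph arc_to_ends_def)

text \<open>The in-degree is controlled by the full fibre of \<open>f\<close> over \<open>v\<close>,
  not only by its part in \<open>W\<close>, so the bound is independent of which vertices are
  deleted.\<close>

lemma total_degree_function_digraph_le: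
  assumes "W \<subseteq> {..<n}"
  shows "total_degree (function_digraph f d W) v \<le> d + card {p \<in> {..<n} \<times> {..<d}. f p = v}"
proof -
  let ?A = "(\<lambda>i. (v, f (v, i))) ` {..<d}"
  let ?I = "{p \<in> {..<n} \<times> {..<d}. f p = v}"
  let ?B = "(\<lambda>p. (fst p, v)) ` ?I"
  have "{e \<in> arcs (function_digraph f d W). fst e = v \<or> snd e = v} \<subseteq> ?A \<union> ?B"
    using assms by (force simp: function_digraph_def image_iff)
  hence "total_degree (function_digraph f d W) v \<le> card (?A \<union> ?B)"
    unfolding total_degree_def by (auto intro!: card_mono)
  also have "\<dots> \<le> card ?A + card ?B" by (rule card_Un_le)
  also have "card ?A \<le> d" using card_image_le[of "{..<d}"] by fastforce
  also have "card ?B \<le> card ?I" by (intro card_image_le) auto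
  finally show ?thesis by simp
qed

section \<open>Splitting acyclic sets\<close>

text \<open>Without cycles the converse of the arc relation on the finite set \<open>A\<close> is
  well-founded, and a minimal element is a sink relative to \<open>A\<close>.\<close>

lemma (in wf_digraph) exists_sink:
  assumes fin: "finite A" and ne: "A \<noteq> {}"
    and acyc: "\<nexists>p. cycle p"
  obtains v where "v \<in> A" "\<And>w. w \<in> A \<Longrightarrow> (v, w) \<notin> arcs_ends G"
proof -
  define r where "r = (arcs_ends G \<inter> A \<times> A)\<inverse>"
  have "acyclic (arcs_ends G \<inter> A \<times> A)"
  proof (rule acyclicI, intro allI notI)
    fix x assume "(x, x) \<in> (arcs_ends G \<inter> A \<times> A)\<^sup>+"
    hence "(x, x) \<in> (arcs_ends G)\<^sup>+" by (rule trancl_mono) auto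
    hence "\<exists>p. awalk x p x \<and> p \<noteq> []" by (simp flip: reachable1_awalk)
    then obtain p where "closed_w p" by (auto simp: closed_w_def)
    thus False using acyc closed_w_imp_cycle by blast
  qed
  hence "wf r" unfolding r_def
    by (intro finite_acyclic_wf_converse) (use fin in auto)
  then obtain v where "v \<in> A" "\<And>w. (w, v) \<in> r \<Longrightarrow> w \<notin> A"
    using ne by (metis wfE_min ex_in_conv)
  thus ?thesis using that unfolding r_def by blast
qed

text \<open>Collecting sinks one after the other yields an initial segment of a reversed topological order.\<close>

lemma (in wf_digraph) acyclic_closed_subset:
  assumes fin: "finite (verts G)" and acyc: "\<nexists>p. cycle p" and "k \<le> card (verts G)"
  shows "\<exists>B \<subseteq> verts G. card B = k \<and> arcs_ends G \<inter> B \<times> (verts G - B) = {}"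
  using assms(3)
proof (induction k)
  case 0
  show ?case by (intro exI[of _ "{}"]) auto
next
  case (Suc k)
  then obtain B where B: "B \<subseteq> verts G" "card B = k" "arcs_ends G \<inter> B \<times> (verts G - B) = {}"
    by auto
  have "verts G - B \<noteq> {}"
    using B Suc.prems by (metis Diff_eq_empty_iff subset_antisym Suc_n_not_le_n)
  then obtain v where v: "v \<in> verts G - B" "\<And>w. w \<in> verts G - B \<Longrightarrow> (v, w) \<notin> arcs_ends G"
    using exists_sink[of "verts G - B"] fin acyc by auto
  have "finite B" using B fin finite_subset by blast
  thus ?case using B v by (intro exI[of _ "insert v B"]) auto
qed

text \<open>Take for \<open>X\<close> a closed segment of size \<open>m\<close>, for
  \<open>Y\<close> any \<open>m\<close> further elements of \<open>A\<close>. As \<open>X\<close>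
  and \<open>Y\<close> are disjoint, a value \<open>f (v, i)\<close> in \<open>Y\<close> differs
  from \<open>v\<close> and would be a genuine arc leaving \<open>X\<close>.\<close>

lemma acyclic_set_function_digraph_split:
  assumes fin: "finite W" and acyc: "acyclic_set (function_digraph f d W) A"
    and card: "2 * m \<le> card A"
  obtains X Y where "X \<subseteq> W" "Y \<subseteq> W" "card X = m" "card Y = m"
    "\<And>v i. v \<in> X \<Longrightarrow> i < d \<Longrightarrow> f (v, i) \<notin> Y"
proof -
  let ?D = "function_digraph f d W"
  let ?G = "?D \<restriction> A"
  have AW: "A \<subseteq> W" using acyc by (simp add: acyclic_set_def)
  interpret D: digraph ?D by (rule digraph_function_digraph[OF fin])
  interpret G: wf_digraph ?G by (rule D.wellformed_induce_subgraph)
  have finA: "finite A" using fin AW finite_subset by blast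
  have [simp]: "verts ?G = A" by (simp add: induce_subgraph_verts)
  obtain X where X: "X \<subseteq> A" "card X = m" "arcs_ends ?G \<inter> X \<times> (A - X) = {}"
    using G.acyclic_closed_subset[of m] acyc finA card by (auto simp: acyclic_set_def)
  have "m \<le> card (A - X)"
    using X card finA by (subst card_Diff_subset) (auto intro: finite_subset)
  then obtain Y where Y: "Y \<subseteq> A - X" "card Y = m"
    using obtain_subset_with_card_n by metis
  have "f (v, i) \<notin> Y" if "v \<in> X" "i < d" for v i
  proof
    assume "f (v, i) \<in> Y"
    hence "(v, f (v, i)) \<in> arcs ?G"
      using that X Y AW by (auto simp: induce_subgraph_def mem_arcs_function_digraph)
    hence "(v, f (v, i)) \<in> arcs_ends ?G"
      by (force simp: arcs_ends_def arc_to_ends_def induce_subgraph_def)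
    thus False using X Y \<open>f (v, i) \<in> Y\<close> that by blast
  qed
  thus ?thesis using that[of X Y] X Y AW by blast
qed

section \<open>Bounds for chromatic number, degree and girth\<close>

lemma card_le_chromatic_number:
  assumes fin: "finite (verts D)" and loopfree: "loopfree_digraph D"
    and bound: "\<And>A. acyclic_set D A \<Longrightarrow> card A \<le> s"
  shows "card (verts D) \<le> chromatic_number D * s"
proof -
  interpret loopfree_digraph D by fact
  \<comment> \<open>The partition into singletons shows that some number of colours suffices, so the
    \<open>LEAST\<close> is attained; singletons are acyclic because there are no loops.\<close>
  have "acyclic_colourable D (card (verts D))"
    unfolding acyclic_colourable_def
  proof (intro exI[of _ "(\<lambda>v. {v}) ` verts D"] conjI ballI)
    show "partition_on (verts D) ((\<lambda>v. {v}) ` verts D)"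
      by (auto simp: partition_on_def disjoint_def)
    show "card ((\<lambda>v. {v}) ` verts D) \<le> card (verts D)" by (rule card_image_le[OF fin])
    fix A assume "A \<in> (\<lambda>v. {v}) ` verts D"
    then obtain v where v: "A = {v}" "v \<in> verts D" by auto
    have "arcs (D \<restriction> A) = {}" using v by (auto simp: induce_subgraph_def dest: no_loops)
    hence "\<nexists>p. pre_digraph.cycle (D \<restriction> A) p"
      unfolding pre_digraph.cycle_def pre_digraph.awalk_def by (metis set_empty subset_empty)
    thus "acyclic_set D A" using v by (simp add: acyclic_set_def)
  qed (use fin in auto)
  hence "acyclic_colourable D (chromatic_number D)"
    unfolding chromatic_number_def by (rule LeastI)
  then obtain P where P: "partition_on (verts D) P" "finite P" "card P \<le> chromatic_number D"
    "\<And>A. A \<in> P \<Longrightarrow> acyclic_set D A"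
    by (auto simp: acyclic_colourable_def)
  have "card (verts D) = sum card P"
    using product_partition[OF P(1)] P(1) fin finite_elements by (metis finite_subset partition_onD1 Sup_upper)
  also have "\<dots> \<le> card P * s" using sum_bounded_above[of P card s] bound P(4) by auto
  also have "\<dots> \<le> chromatic_number D * s" using P(3) by simp
  finally show ?thesis .
qed

lemma max_total_degree_le:
  assumes "finite (verts D)" "\<And>v. v \<in> verts D \<Longrightarrow> total_degree D v \<le> k"
  shows "max_total_degree D \<le> k"
  using assms by (simp add: max_total_degree_def)

lemma girth_ge:
  assumes "\<And>vs es. underlying_cycle D vs es \<Longrightarrow> g \<le> length es"
  shows "girth D \<ge> enat g"
  unfolding girth_def by (rule Inf_greatest) (use assms in auto)

section \<open>Encoding short cycles\<close>

text \<open>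
  A cycle through the vertices \<open>v\<^sub>0, \<dots>, v\<^sub>k\<^sub>-\<^sub>1\<close> is encoded by the list of triples \<open>(v\<^sub>l, b\<^sub>l, i\<^sub>l)\<close>:
  the edge between \<open>v\<^sub>l\<close> and its successor is the \<open>i\<^sub>l\<close>-th arc chosen by its tail, and \<open>b\<^sub>l\<close> tells
  whether the tail is \<open>v\<^sub>l\<close>.
\<close>

definition cycle_source :: "(nat \<times> bool \<times> nat) list \<Rightarrow> nat \<Rightarrow> nat \<times> nat" where
  "cycle_source c l =
     (if fst (snd (c ! l)) then fst (c ! l) else fst (c ! (Suc l mod length c)), snd (snd (c ! l)))"

definition cycle_target :: "(nat \<times> bool \<times> nat) list \<Rightarrow> nat \<Rightarrow> nat" where
  "cycle_target c l =
     (if fst (snd (c ! l)) then fst (c ! (Suc l mod length c)) else fst (c ! l))"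

text \<open>Injectivity of the sources makes \<open>realises\<close> a prescription of
  \<open>f\<close> at \<open>k\<close> distinct arguments, which has probability exactly
  \<open>1 / n ^ k\<close>.\<close>

definition cycle_codes :: "nat \<Rightarrow> nat \<Rightarrow> nat \<Rightarrow> (nat \<times> bool \<times> nat) list set" where
  "cycle_codes n d k =
     {c. set c \<subseteq> {..<n} \<times> UNIV \<times> {..<d} \<and> length c = k \<and> inj_on (cycle_source c) {..<k}}"

definition realises :: "(nat \<times> nat \<Rightarrow> nat) \<Rightarrow> (nat \<times> bool \<times> nat) list \<Rightarrow> bool" where
  "realises f c \<longleftrightarrow> (\<forall>l<length c. f (cycle_source c l) = cycle_target c l)"

text \<open>One vertex per short cycle is enough to destroy it. For \<open>k = 0\<close> the empty
  code is realised trivially and contributes the unspecified value \<open>fst (hd [])\<close>: one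
  harmless extra vertex.\<close>

definition short_cycle_verts :: "nat \<Rightarrow> nat \<Rightarrow> nat \<Rightarrow> (nat \<times> nat \<Rightarrow> nat) \<Rightarrow> nat set" where
  "short_cycle_verts n d g f = (\<Union>k<g. (\<lambda>c. fst (hd c)) ` {c \<in> cycle_codes n d k. realises f c})"

lemma underlying_cycle_meets_short_cycle_verts:
  assumes cyc: "underlying_cycle (function_digraph f d W) vs es"
    and short: "length es < g" and W: "W \<subseteq> {..<n}"
  shows "W \<inter> short_cycle_verts n d g f \<noteq> {}"
proof -
  define k where "k = length es"
  have k: "k > 0" "length vs = k" "distinct es"
    and arcs: "set es \<subseteq> arcs (function_digraph f d W)"
    and ends: "\<And>l. l < k \<Longrightarrow> {fst (es ! l), snd (es ! l)} = {vs ! l, vs ! (Suc l mod k)}"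
    using cyc by (auto simp: underlying_cycle_def k_def)
  have arc: "es ! l \<in> arcs (function_digraph f d W)" if "l < k" for l
    using arcs that by (auto simp: k_def)
  hence "\<forall>l. \<exists>i. l < k \<longrightarrow> i < d \<and> snd (es ! l) = f (fst (es ! l), i)"
    by (auto simp: mem_arcs_function_digraph)
  \<comment> \<open>Several indices may give the same arc; one of them is fixed.\<close>
  then obtain i where i: "\<And>l. l < k \<Longrightarrow> i l < d \<and> snd (es ! l) = f (fst (es ! l), i l)"
    by metis
  have vsW: "vs ! l \<in> W" if "l < k" for l
    using ends[OF that] arc[OF that] by (auto simp: mem_arcs_function_digraph doubleton_eq_iff)
  define c where "c = map (\<lambda>l. (vs ! l, fst (es ! l) = vs ! l, i l)) [0..<k]"
  have len: "length c = k" by (simp add: c_def)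
  have nth: "c ! l = (vs ! l, fst (es ! l) = vs ! l, i l)" if "l < k" for l
    using that by (simp add: c_def)
  have src: "cycle_source c l = (fst (es ! l), i l)" and tgt: "cycle_target c l = snd (es ! l)"
    if "l < k" for l
  proof -
    have "Suc l mod k < k" using k by simp
    thus "cycle_source c l = (fst (es ! l), i l)" "cycle_target c l = snd (es ! l)"
      using that nth ends[OF that]
      by (auto simp: cycle_source_def cycle_target_def len doubleton_eq_iff)
  qed
  have "inj_on (cycle_source c) {..<k}"
  proof (rule inj_onI)
    fix l l' assume l: "l \<in> {..<k}" "l' \<in> {..<k}" and eq: "cycle_source c l = cycle_source c l'"
    \<comment> \<open>Equal sources have equal tail and index, so \<open>f\<close> gives equal
      heads; the arcs coincide and \<open>es\<close> is distinct.\<close>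
    have "es ! l = es ! l'" using eq l src i by (auto simp: prod_eq_iff)
    thus "l = l'" using k l by (auto simp: k_def nth_eq_iff_index_eq)
  qed
  moreover have "set c \<subseteq> {..<n} \<times> UNIV \<times> {..<d}" using vsW W i by (force simp: c_def)
  ultimately have "c \<in> cycle_codes n d k" by (simp add: cycle_codes_def len)
  moreover have "realises f c" using i src tgt by (auto simp: realises_def len)
  moreover have "fst (hd c) = vs ! 0" using k nth[of 0] len by (subst hd_conv_nth) auto
  ultimately have "vs ! 0 \<in> short_cycle_verts n d g f"
    using short unfolding short_cycle_verts_def k_def by (auto intro!: image_eqI[of _ _ c])
  thus ?thesis using vsW[of 0] k by auto
qed

section \<open>Counting functions\<close>

text \<open>This is independence of the values of \<open>f\<close> in division-free form: the
  constrained functions again form a product, with \<open>B x\<close> in place of \<open>V\<close>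
  at each \<open>x\<close> in \<open>S\<close>.\<close>

lemma card_constrained_functions:
  assumes "finite P" "finite V" "S \<subseteq> P" "\<And>x. x \<in> S \<Longrightarrow> B x \<subseteq> V"
  shows "card {f \<in> P \<rightarrow>\<^sub>E V. \<forall>x\<in>S. f x \<in> B x} * card V ^ card S = card V ^ card P * (\<Prod>x\<in>S. card (B x))"
proof -
  have fin: "finite S" using assms finite_subset by blast
  have "{f \<in> P \<rightarrow>\<^sub>E V. \<forall>x\<in>S. f x \<in> B x} = (\<Pi>\<^sub>E x\<in>P. if x \<in> S then B x else V)"
    (is "?L = ?R")
  proof (intro equalityI subsetI)
    fix f assume "f \<in> ?L"
    thus "f \<in> ?R" by (auto simp: PiE_iff)
  next
    fix f assume "f \<in> ?R"
    hence f: "f \<in> extensional P" "\<And>x. x \<in> P \<Longrightarrow> f x \<in> (if x \<in> S then B x else V)"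
      by (auto simp: PiE_iff)
    have "f x \<in> V" if "x \<in> P" for x using f(2)[OF that] assms(4)[of x] by (auto split: if_splits)
    moreover have "f x \<in> B x" if "x \<in> S" for x using f(2)[of x] that assms(3) by auto
    ultimately show "f \<in> ?L" using f(1) by (auto simp: PiE_iff)
  qed
  hence "card ?L = (\<Prod>x\<in>P. card (if x \<in> S then B x else V))"
    using assms by (simp add: card_PiE)
  also have "\<dots> = (\<Prod>x\<in>S. card (B x)) * card V ^ card (P - S)"
    using assms fin by (subst prod.subset_diff[of S P]) (auto simp: mult.commute)
  finally show ?thesis
    using assms fin by (simp add: card_Diff_subset card_mono flip: power_add)
qed

lemma card_functions_prescribed:
  assumes "finite P" "finite V" "V \<noteq> {}" "S \<subseteq> P" "\<And>x. x \<in> S \<Longrightarrow> h x \<in> V"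
  shows "real (card {f \<in> P \<rightarrow>\<^sub>E V. \<forall>x\<in>S. f x = h x}) =
    real (card V) ^ card P / real (card V) ^ card S"
proof -
  have "card {f \<in> P \<rightarrow>\<^sub>E V. \<forall>x\<in>S. f x \<in> {h x}} * card V ^ card S = card V ^ card P"
    using card_constrained_functions[of P V S "\<lambda>x. {h x}"] assms by auto
  hence "real (card {f \<in> P \<rightarrow>\<^sub>E V. \<forall>x\<in>S. f x = h x}) * real (card V) ^ card S = real (card V) ^ card P"
    by (simp flip: of_nat_power of_nat_mult)
  thus ?thesis using assms by (simp add: field_simps)
qed

section \<open>Expected number of short cycles\<close>

lemma card_realising_functions:
  assumes "c \<in> cycle_codes n d k" "n > 0"
  shows "real (card {f \<in> {..<n} \<times> {..<d} \<rightarrow>\<^sub>E {..<n}. realises f c}) = real n ^ (n * d) / real n ^ k"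
proof -
  let ?S = "cycle_source c ` {..<k}"
  \<comment> \<open>The targets, indexed by positions, become a function of the sources; injectivity
    makes this well-defined.\<close>
  define h where "h = (\<lambda>x. cycle_target c (the_inv_into {..<k} (cycle_source c) x))"
  have len: "length c = k" and inj: "inj_on (cycle_source c) {..<k}"
    and sub: "set c \<subseteq> {..<n} \<times> UNIV \<times> {..<d}"
    using assms by (auto simp: cycle_codes_def)
  have h: "h (cycle_source c l) = cycle_target c l" if "l < k" for l
    using inj that by (simp add: h_def the_inv_into_f_f)
  have mem: "fst (c ! l) < n" "snd (snd (c ! l)) < d" if "l < k" for l
    using subsetD[OF sub nth_mem[of l c]] that len by (auto simp: mem_Times_iff)
  have "Suc l mod k < k" if "l < k" for l using that by simp
  hence "?S \<subseteq> {..<n} \<times> {..<d}" and tgt: "cycle_target c l < n" if "l < k" for l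
    using mem that by (auto simp: cycle_source_def cycle_target_def len)
  \<comment> \<open>The inclusion was derived in the presence of a position \<open>l < k\<close>, so
    the empty code is treated separately.\<close>
  hence S: "?S \<subseteq> {..<n} \<times> {..<d}" by (cases "k = 0") auto
  have "{f \<in> {..<n} \<times> {..<d} \<rightarrow>\<^sub>E {..<n}. realises f c} =
        {f \<in> {..<n} \<times> {..<d} \<rightarrow>\<^sub>E {..<n}. \<forall>x\<in>?S. f x = h x}"
    using h by (auto simp: realises_def len)
  moreover have "h x \<in> {..<n}" if "x \<in> ?S" for x using that h tgt by auto
  ultimately show ?thesis
    using card_functions_prescribed[of "{..<n} \<times> {..<d}" "{..<n}" ?S h] S assms(2) inj
    by (simp add: card_image card_cartesian_product lessThan_empty_iff)
qed

lemma sum_card_Collect_swap: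
  assumes "finite A" "finite B"
  shows "(\<Sum>x\<in>A. card {y \<in> B. R x y}) = (\<Sum>y\<in>B. card {x \<in> A. R x y})"
proof -
  have "(\<Sum>x\<in>A. card {y \<in> B. R x y}) = (\<Sum>x\<in>A. \<Sum>y\<in>B. of_bool (R x y))"
    using assms by (simp add: Int_def)
  also have "\<dots> = (\<Sum>y\<in>B. \<Sum>x\<in>A. of_bool (R x y))" by (rule sum.swap)
  also have "\<dots> = (\<Sum>y\<in>B. card {x \<in> A. R x y})"
    using assms by (simp add: Int_def)
  finally show ?thesis .
qed

lemma cycle_codes_bound:
  "finite (cycle_codes n d k)" "card (cycle_codes n d k) \<le> (2 * n * d) ^ k"
proof -
  let ?T = "{..<n} \<times> (UNIV :: bool set) \<times> {..<d}"
  have sub: "cycle_codes n d k \<subseteq> {c. set c \<subseteq> ?T \<and> length c = k}"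
    by (auto simp: cycle_codes_def)
  have fin: "finite {c. set c \<subseteq> ?T \<and> length c = k}" by (rule finite_lists_length_eq) auto
  show "finite (cycle_codes n d k)" using sub fin finite_subset by blast
  have "card (cycle_codes n d k) \<le> card {c. set c \<subseteq> ?T \<and> length c = k}"
    using sub fin by (rule card_mono[rotated])
  also have "\<dots> = (2 * n * d) ^ k"
    by (subst card_lists_length_eq) (auto simp: card_cartesian_product mult_ac)
  finally show "card (cycle_codes n d k) \<le> (2 * n * d) ^ k" .
qed

text \<open>There are at most \<open>(2 * n * d) ^ k\<close> codes of length \<open>k\<close>, each
  realised with probability \<open>1 / n ^ k\<close>. The powers of \<open>n\<close> cancel, so the
  expectation is bounded independently of \<open>n\<close>.\<close>

lemma sum_card_short_cycle_verts:
  assumes "n > 0"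
  shows "real (\<Sum>f\<in>{..<n} \<times> {..<d} \<rightarrow>\<^sub>E {..<n}. card (short_cycle_verts n d g f))
    \<le> real n ^ (n * d) * (\<Sum>k<g. (2 * real d) ^ k)"
proof -
  let ?F = "{..<n} \<times> {..<d} \<rightarrow>\<^sub>E {..<n}"
  have finF: "finite ?F" by (intro finite_PiE) auto
  have "card (short_cycle_verts n d g f) \<le> (\<Sum>k<g. card {c \<in> cycle_codes n d k. realises f c})" for f
  proof -
    have "card (short_cycle_verts n d g f)
      \<le> (\<Sum>k<g. card ((\<lambda>c. fst (hd c)) ` {c \<in> cycle_codes n d k. realises f c}))"
      unfolding short_cycle_verts_def by (rule card_UN_le) simp
    also have "\<dots> \<le> (\<Sum>k<g. card {c \<in> cycle_codes n d k. realises f c})"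
      by (intro sum_mono card_image_le) (simp add: cycle_codes_bound)
    finally show ?thesis .
  qed
  hence "(\<Sum>f\<in>?F. card (short_cycle_verts n d g f))
    \<le> (\<Sum>f\<in>?F. \<Sum>k<g. card {c \<in> cycle_codes n d k. realises f c})"
    by (rule sum_mono)
  also have "\<dots> = (\<Sum>k<g. \<Sum>f\<in>?F. card {c \<in> cycle_codes n d k. realises f c})"
    by (rule sum.swap)
  also have "\<dots> = (\<Sum>k<g. \<Sum>c\<in>cycle_codes n d k. card {f \<in> ?F. realises f c})"
    by (intro sum.cong sum_card_Collect_swap finF cycle_codes_bound refl)
  finally have "real (\<Sum>f\<in>?F. card (short_cycle_verts n d g f))
    \<le> real (\<Sum>k<g. \<Sum>c\<in>cycle_codes n d k. card {f \<in> ?F. realises f c})"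
    by (rule of_nat_mono)
  also have "\<dots> = (\<Sum>k<g. real (card (cycle_codes n d k)) * (real n ^ (n * d) / real n ^ k))"
    using card_realising_functions[OF _ assms] by simp
  also have "\<dots> \<le> (\<Sum>k<g. real ((2 * n * d) ^ k) * (real n ^ (n * d) / real n ^ k))"
    by (intro sum_mono mult_right_mono of_nat_mono cycle_codes_bound) auto
  also have "\<dots> = (\<Sum>k<g. real n ^ (n * d) * (2 * real d) ^ k)"
    using assms by (intro sum.cong) (auto simp: power_mult_distrib field_simps)
  finally show ?thesis by (simp add: sum_distrib_left)
qed

section \<open>Second moment of the in-degrees\<close>

lemma card_collision_functions:
  assumes "p \<in> P" "q \<in> P" "p \<noteq> q" "finite P" "n > 0"
  shows "real (card {f \<in> P \<rightarrow>\<^sub>E {..<n}. f p = f q}) = real n ^ card P / real n"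
proof -
  have fin: "finite (P \<rightarrow>\<^sub>E {..<n})" using assms by (intro finite_PiE) auto
  have "{f \<in> P \<rightarrow>\<^sub>E {..<n}. f p = f q} =
        (\<Union>c<n. {f \<in> P \<rightarrow>\<^sub>E {..<n}. \<forall>x\<in>{p, q}. f x = c})"
    using assms by (auto simp: PiE_iff)
  also have "card \<dots> = (\<Sum>c<n. card {f \<in> P \<rightarrow>\<^sub>E {..<n}. \<forall>x\<in>{p, q}. f x = c})"
    using fin by (intro card_UN_disjoint) auto
  also have "real \<dots> = (\<Sum>c<n. real n ^ card P / real n ^ 2)"
    unfolding of_nat_sum
  proof (intro sum.cong refl)
    fix c assume "c \<in> {..<n}"
    thus "real (card {f \<in> P \<rightarrow>\<^sub>E {..<n}. \<forall>x\<in>{p, q}. f x = c}) = real n ^ card P / real n ^ 2"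
      using card_functions_prescribed[of P "{..<n}" "{p, q}" "\<lambda>_. c"] assms
      by (auto simp: numeral_2_eq_2)
  qed
  also have "\<dots> = real n ^ card P / real n" by (simp add: power2_eq_square)
  finally show ?thesis .
qed

text \<open>The squared fibre sizes count ordered pairs with equal values. The diagonal contributes
  \<open>card P\<close>; any other pair collides with probability \<open>1 / n\<close>.\<close>

lemma sum_fibre_card_squared:
  assumes "finite P" "n > 0"
  shows "(\<Sum>f\<in>P \<rightarrow>\<^sub>E {..<n}. \<Sum>v<n. (real (card {p \<in> P. f p = v}))\<^sup>2)
    \<le> real n ^ card P * (real (card P) + (real (card P))\<^sup>2 / real n)"
proof -
  let ?F = "P \<rightarrow>\<^sub>E {..<n}"
  have finF: "finite ?F" using assms by (intro finite_PiE) auto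
  have "(\<Sum>v<n. (card {p \<in> P. f p = v})\<^sup>2) = card {z \<in> P \<times> P. f (fst z) = f (snd z)}"
    if "f \<in> ?F" for f
  proof -
    have "{z \<in> P \<times> P. f (fst z) = f (snd z)} =
      (\<Union>v<n. {p \<in> P. f p = v} \<times> {p \<in> P. f p = v})"
      using that by (auto simp: PiE_iff)
    also have "card \<dots> = (\<Sum>v<n. card ({p \<in> P. f p = v} \<times> {p \<in> P. f p = v}))"
      using assms by (intro card_UN_disjoint) auto
    finally show ?thesis by (simp add: card_cartesian_product power2_eq_square)
  qed
  hence "(\<Sum>f\<in>?F. \<Sum>v<n. (card {p \<in> P. f p = v})\<^sup>2)
    = (\<Sum>f\<in>?F. card {z \<in> P \<times> P. f (fst z) = f (snd z)})"
    by simp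
  also have "\<dots> = (\<Sum>z\<in>P \<times> P. card {f \<in> ?F. f (fst z) = f (snd z)})"
    using assms finF by (intro sum_card_Collect_swap) auto
  finally have "(\<Sum>f\<in>?F. \<Sum>v<n. (real (card {p \<in> P. f p = v}))\<^sup>2)
    = (\<Sum>z\<in>P \<times> P. real (card {f \<in> ?F. f (fst z) = f (snd z)}))"
    by (simp flip: of_nat_power of_nat_sum)
  \<comment> \<open>The collision term is granted to diagonal pairs as well, which gives the round
    value \<open>(card P)\<^sup>2 / n\<close>.\<close>
  also have "\<dots> \<le> (\<Sum>z\<in>P \<times> P. real n ^ card P / real n + of_bool (fst z = snd z) * real n ^ card P)"
  proof (intro sum_mono)
    fix z assume z: "z \<in> P \<times> P"
    show "real (card {f \<in> ?F. f (fst z) = f (snd z)})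
      \<le> real n ^ card P / real n + of_bool (fst z = snd z) * real n ^ card P"
    proof (cases "fst z = snd z")
      case True
      have "card {f \<in> ?F. f (fst z) = f (snd z)} \<le> card ?F" using finF by (intro card_mono) auto
      also have "\<dots> = n ^ card P" using assms by (simp add: card_PiE)
      finally show ?thesis using True by (simp add: add_increasing flip: of_nat_power)
    next
      case False
      thus ?thesis using card_collision_functions[of "fst z" P "snd z" n] z assms by auto
    qed
  qed
  also have "\<dots> = (real (card P))\<^sup>2 * (real n ^ card P / real n)
    + real (card {z \<in> P \<times> P. fst z = snd z}) * real n ^ card P"
    using assms by (simp add: sum.distrib card_cartesian_product power2_eq_square Int_def
        flip: sum_distrib_right)
  also have "{z \<in> P \<times> P. fst z = snd z} = (\<lambda>p. (p, p)) ` P" by auto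
  also have "card \<dots> = card P" by (intro card_image inj_onI) auto
  finally show ?thesis by (simp add: algebra_simps)
qed

text \<open>Chebyshev's inequality, averaged over \<open>f\<close>: the fibre sizes have mean
  \<open>d\<close>, and their squared deviations sum to at most \<open>n * d\<close> in
  expectation.\<close>

lemma sum_card_large_fibres:
  assumes "n > 0" "t > 0"
  shows "real (\<Sum>f\<in>{..<n} \<times> {..<d} \<rightarrow>\<^sub>E {..<n}.
            card {v \<in> {..<n}. real d + t \<le> real (card {p \<in> {..<n} \<times> {..<d}. f p = v})})
    \<le> real n ^ (n * d) * (real n * real d / t\<^sup>2)"
proof -
  let ?P = "{..<n} \<times> {..<d}"
  let ?F = "?P \<rightarrow>\<^sub>E {..<n}"
  let ?i = "\<lambda>f v. real (card {p \<in> ?P. f p = v})"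
  have finF: "finite ?F" by (intro finite_PiE) auto
  have cardP: "card ?P = n * d" by (simp add: card_cartesian_product)
  have cardF: "card ?F = n ^ (n * d)" by (simp add: card_PiE card_cartesian_product)
  \<comment> \<open>The fibres partition the domain, so the mean fibre size is \<open>d\<close> for
    every single \<open>f\<close>.\<close>
  have fibres: "(\<Sum>v<n. ?i f v) = real n * real d" if "f \<in> ?F" for f
  proof -
    have "(\<Sum>v<n. card {p \<in> ?P. f p = v}) = card (\<Union>v<n. {p \<in> ?P. f p = v})"
      by (intro card_UN_disjoint[symmetric]) auto
    also have "(\<Union>v<n. {p \<in> ?P. f p = v}) = ?P" using that by (auto simp: PiE_iff)
    finally show ?thesis by (simp add: card_cartesian_product flip: of_nat_sum of_nat_mult)
  qed
  have "t\<^sup>2 * real (card {v \<in> {..<n}. real d + t \<le> ?i f v})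
    \<le> (\<Sum>v<n. (?i f v)\<^sup>2) - real n * (real d)\<^sup>2" if f: "f \<in> ?F" for f
  proof -
    have "t\<^sup>2 * real (card {v \<in> {..<n}. real d + t \<le> ?i f v})
      = (\<Sum>v | v \<in> {..<n} \<and> real d + t \<le> ?i f v. t\<^sup>2)"
      by simp
    also have "\<dots> \<le> (\<Sum>v | v \<in> {..<n} \<and> real d + t \<le> ?i f v. (?i f v - real d)\<^sup>2)"
      using assms by (intro sum_mono power_mono) auto
    also have "\<dots> \<le> (\<Sum>v<n. (?i f v - real d)\<^sup>2)"
      by (intro sum_mono2) auto
    also have "\<dots> = (\<Sum>v<n. (?i f v)\<^sup>2) - 2 * real d * (\<Sum>v<n. ?i f v) + real n * (real d)\<^sup>2"
      by (simp add: power2_diff sum.distrib sum_subtractf sum_distrib_left algebra_simps)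
    finally show ?thesis unfolding fibres[OF f] by (simp add: power2_eq_square algebra_simps)
  qed
  hence "(\<Sum>f\<in>?F. t\<^sup>2 * real (card {v \<in> {..<n}. real d + t \<le> ?i f v}))
    \<le> (\<Sum>f\<in>?F. (\<Sum>v<n. (?i f v)\<^sup>2) - real n * (real d)\<^sup>2)"
    by (rule sum_mono)
  also have "\<dots> = (\<Sum>f\<in>?F. \<Sum>v<n. (?i f v)\<^sup>2) - real n ^ (n * d) * (real n * (real d)\<^sup>2)"
    by (simp add: sum_subtractf cardF)
  also have "\<dots> \<le> real n ^ (n * d) * (real (n * d) + (real (n * d))\<^sup>2 / real n)
      - real n ^ (n * d) * (real n * (real d)\<^sup>2)"
    using sum_fibre_card_squared[of ?P n] assms unfolding cardP by simp
  \<comment> \<open>The square of \<open>n * d\<close> divided by \<open>n\<close> cancels against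
    \<open>n\<close> times the square of \<open>d\<close>.\<close>
  also have "\<dots> = real n ^ (n * d) * (real n * real d)"
    using assms by (simp add: field_simps power2_eq_square)
  finally show ?thesis using assms by (simp add: field_simps flip: sum_distrib_left)
qed

section \<open>Pairs of sets without arcs between them\<close>

text \<open>The sets range over all of \<open>{..<n}\<close>, so that the event depends on
  \<open>f\<close> alone and can be excluded before any vertex is deleted.\<close>

definition arcless_pair :: "nat \<Rightarrow> nat \<Rightarrow> nat \<Rightarrow> (nat \<times> nat \<Rightarrow> nat) \<Rightarrow> bool" where
  "arcless_pair n d m f \<longleftrightarrow> (\<exists>X Y. X \<subseteq> {..<n} \<and> Y \<subseteq> {..<n} \<and> card X = m \<and> card Y = m \<and>
     (\<forall>v\<in>X. \<forall>i<d. f (v, i) \<notin> Y))"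

text \<open>Union bound over the pairs of \<open>m\<close>-sets: for a fixed pair,
  \<open>m * d\<close> independent values of \<open>f\<close> must all avoid
  \<open>Y\<close>.\<close>

lemma card_arcless_pair_functions:
  assumes "n > 0"
  shows "real (card {f \<in> {..<n} \<times> {..<d} \<rightarrow>\<^sub>E {..<n}. arcless_pair n d m f})
    \<le> real n ^ (n * d) * ((real (n choose m))\<^sup>2 * (real (n - m) / real n) ^ (m * d))"
proof -
  let ?P = "{..<n} \<times> {..<d}"
  let ?F = "?P \<rightarrow>\<^sub>E {..<n}"
  let ?C = "{X. X \<subseteq> {..<n} \<and> card X = m}"
  let ?E = "\<lambda>z. {f \<in> ?F. \<forall>x \<in> fst z \<times> {..<d}. f x \<in> {..<n} - snd z}"
  have finF: "finite ?F" by (intro finite_PiE) auto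
  have cardC: "card ?C = n choose m" using n_subsets[of "{..<n}" m] by simp
  have E: "real (card (?E z)) = real n ^ (n * d) * (real (n - m) / real n) ^ (m * d)"
    if z: "z \<in> ?C \<times> ?C" for z
  proof -
    have "card (?E z) * card {..<n} ^ card (fst z \<times> {..<d})
      = card {..<n} ^ card ?P * (\<Prod>x\<in>fst z \<times> {..<d}. card ({..<n} - snd z))"
      using z by (intro card_constrained_functions) auto
    moreover have "card ({..<n} - snd z) = n - m"
      using z finite_subset[of "snd z" "{..<n}"] by (subst card_Diff_subset) auto
    moreover have "card (fst z \<times> {..<d}) = m * d" using z by (auto simp: card_cartesian_product)
    moreover have "card ?P = n * d" by (simp add: card_cartesian_product)
    ultimately have "card (?E z) * n ^ (m * d) = n ^ (n * d) * (n - m) ^ (m * d)"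
      by (simp only: card_lessThan prod_constant)
    hence "real (card (?E z)) * real n ^ (m * d) = real n ^ (n * d) * real (n - m) ^ (m * d)"
      by (simp flip: of_nat_power of_nat_mult)
    thus ?thesis using assms by (simp add: field_simps power_divide)
  qed
  have "{f \<in> ?F. arcless_pair n d m f} \<subseteq> (\<Union>z\<in>?C \<times> ?C. ?E z)"
  proof
    fix f assume f: "f \<in> {f \<in> ?F. arcless_pair n d m f}"
    then obtain X Y where XY: "X \<subseteq> {..<n}" "Y \<subseteq> {..<n}" "card X = m" "card Y = m"
      "\<forall>v\<in>X. \<forall>i<d. f (v, i) \<notin> Y" by (auto simp: arcless_pair_def)
    have "f x \<in> {..<n} - Y" if "x \<in> X \<times> {..<d}" for x
      using that f XY by (force simp: PiE_iff)
    hence "f \<in> ?E (X, Y)" using f by simp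
    thus "f \<in> (\<Union>z\<in>?C \<times> ?C. ?E z)" using XY by blast
  qed
  hence "card {f \<in> ?F. arcless_pair n d m f} \<le> card (\<Union>z\<in>?C \<times> ?C. ?E z)"
    using finF by (intro card_mono) auto
  also have "\<dots> \<le> (\<Sum>z\<in>?C \<times> ?C. card (?E z))" by (intro card_UN_le) auto
  finally have "real (card {f \<in> ?F. arcless_pair n d m f}) \<le> (\<Sum>z\<in>?C \<times> ?C. real (card (?E z)))"
    by (simp flip: of_nat_sum)
  also have "\<dots> = (\<Sum>z\<in>?C \<times> ?C. real n ^ (n * d) * (real (n - m) / real n) ^ (m * d))"
    by (rule sum.cong[OF refl E])
  also have "\<dots> = real n ^ (n * d) * ((real (n choose m))\<^sup>2 * (real (n - m) / real n) ^ (m * d))"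
    by (simp only: sum_constant card_cartesian_product cardC of_nat_mult power2_eq_square mult_ac)
  finally show ?thesis .
qed

lemma binomial_le_exp_power:
  assumes "m > 0"
  shows "real (n choose m) \<le> (exp 1 * real n / real m) ^ m"
proof -
  \<comment> \<open>The left side is a single term of the exponential series.\<close>
  have "real m ^ m / fact m \<le> exp (real m)"
    using sum_le_suminf[of "\<lambda>k. real m ^ k / fact k" "{m}"] summable_exp[of "real m"]
    by (simp add: exp_def field_simps)
  hence fact: "real m ^ m \<le> exp 1 ^ m * fact m"
    by (simp add: field_simps flip: exp_of_nat_mult)
  have "real (n choose m) * fact m \<le> real n ^ m"
    using of_nat_mono[OF binomial_fact_pow[of n m], where 'a = real] by simp
  hence "real (n choose m) * real m ^ m * fact m \<le> real n ^ m * real m ^ m"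
    by (metis mult.commute mult.assoc mult_left_mono of_nat_0_le_iff zero_le_power)
  also have "\<dots> \<le> real n ^ m * (exp 1 ^ m * fact m)"
    using fact by (intro mult_left_mono) auto
  finally have "real (n choose m) * real m ^ m \<le> (exp 1 * real n) ^ m"
    by (simp add: power_mult_distrib mult_ac)
  thus ?thesis using assms by (simp add: power_divide pos_le_divide_eq)
qed

text \<open>With \<open>L = ln d\<close> and \<open>m / n\<close> at least \<open>2 * L / d\<close>,
  the base of the \<open>m\<close>-th power is at most
  \<open>(exp 1 * d / (2 * L))\<^sup>2 / d\<^sup>2\<close>, that is
  \<open>(exp 1 / L)\<^sup>2 / 4\<close>. The hypothesis \<open>ln d \<ge> exp 1\<close> makes this
  at most \<open>1 / 4\<close>.\<close>

lemma arcless_pair_probability_le: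
  assumes "n > 0" "m > 0" "d > 0" "ln (real d) \<ge> exp 1"
    and m: "2 * ln (real d) / real d * real n \<le> real m"
  shows "(real (n choose m))\<^sup>2 * (real (n - m) / real n) ^ (m * d) \<le> (1 / 4) ^ m"
proof -
  define L where "L = ln (real d)"
  have L: "L \<ge> exp 1" using assms by (simp add: L_def)
  have Lpos: "L > 0" using less_le_trans[OF exp_gt_zero L] .
  have dens: "2 * L / real d \<le> real m / real n"
    using m assms by (simp add: L_def field_simps)
  have "real (n - m) / real n \<le> exp (- (real m / real n))"
  \<comment> \<open>For \<open>m > n\<close> truncated subtraction makes the left side 0.\<close>
  proof (cases "m \<le> n")
    case True
    thus ?thesis using exp_ge_add_one_self[of "- (real m / real n)"] assms(1)
      by (simp add: of_nat_diff field_simps)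
  qed auto
  hence "(real (n - m) / real n) ^ d \<le> exp (- (real m / real n)) ^ d"
    by (intro power_mono) auto
  also have "\<dots> = exp (- (real d * (real m / real n)))"
    by (simp flip: exp_of_nat_mult)
  also have "\<dots> \<le> exp (- (2 * L))"
    using dens assms(3) by (simp add: field_simps)
  also have "\<dots> = 1 / (real d)\<^sup>2"
    using assms(3) by (simp add: exp_minus L_def exp_double inverse_eq_divide)
  finally have A: "(real (n - m) / real n) ^ d \<le> 1 / (real d)\<^sup>2" .
  have "exp 1 * real n / real m = exp 1 / (real m / real n)" by simp
  also have "\<dots> \<le> exp 1 / (2 * L / real d)"
    using dens Lpos assms by (intro divide_left_mono) auto
  finally have B: "exp 1 * real n / real m \<le> exp 1 * real d / (2 * L)" by simp
  have "(real (n choose m))\<^sup>2 * (real (n - m) / real n) ^ (m * d)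
    \<le> ((exp 1 * real n / real m) ^ m)\<^sup>2 * (real (n - m) / real n) ^ (m * d)"
    by (intro mult_right_mono power_mono binomial_le_exp_power assms) auto
  also have "\<dots> = ((exp 1 * real n / real m)\<^sup>2 * (real (n - m) / real n) ^ d) ^ m"
    by (simp add: power_mult_distrib mult.commute flip: power_mult)
  also have "\<dots> \<le> ((exp 1 * real d / (2 * L))\<^sup>2 * (1 / (real d)\<^sup>2)) ^ m"
    by (intro power_mono mult_mono A B) auto
  also have "(exp 1 * real d / (2 * L))\<^sup>2 * (1 / (real d)\<^sup>2) = (exp 1 / L)\<^sup>2 / 4"
    using assms(3) Lpos by (simp add: power2_eq_square field_simps)
  also have "\<dots> ^ m \<le> (1 / 4) ^ m"
    using L Lpos by (intro power_mono) (auto simp: power_le_one_iff)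
  finally show ?thesis .
qed

section \<open>The lower bound\<close>

lemma exists_le_average:
  fixes w :: "'a \<Rightarrow> real"
  assumes "finite F" "F \<noteq> {}" "(\<Sum>f\<in>F. w f) \<le> real (card F) * b"
  obtains f where "f \<in> F" "w f \<le> b"
proof -
  have "\<exists>f\<in>F. w f \<le> b"
  proof (rule ccontr)
    assume "\<not> (\<exists>f\<in>F. w f \<le> b)"
    hence "(\<Sum>f\<in>F. b) < (\<Sum>f\<in>F. w f)" using assms by (intro sum_strict_mono) auto
    thus False using assms by simp
  qed
  thus ?thesis using that by blast
qed

text \<open>First-moment argument with three contributions of at most \<open>n / 16\<close> each:
  \<open>m \<ge> 2\<close> serves the arcless pairs, the bound on \<open>n\<close> the short cycles,
  and the bound on \<open>t\<close> the large in-degrees.\<close>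

lemma exists_good_function:
  assumes "n > 0" "m > 0" "d > 0" "ln (real d) \<ge> exp 1"
    and m: "2 * ln (real d) / real d * real n \<le> real m" "2 \<le> m"
    and t: "t > 0" "16 * real d \<le> t\<^sup>2"
    and n: "16 * (\<Sum>k<g. (2 * real d) ^ k) \<le> real n"
  obtains f where "\<not> arcless_pair n d m f"
    "real (card (short_cycle_verts n d g f)) +
     real (card {v \<in> {..<n}. real d + t \<le> real (card {p \<in> {..<n} \<times> {..<d}. f p = v})})
     \<le> 3 / 16 * real n"
proof -
  let ?F = "{..<n} \<times> {..<d} \<rightarrow>\<^sub>E {..<n}"
  let ?N = "real n ^ (n * d)"
  let ?H = "\<lambda>f. {v \<in> {..<n}. real d + t \<le> real (card {p \<in> {..<n} \<times> {..<d}. f p = v})}"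
  \<comment> \<open>An arcless pair alone costs \<open>n\<close>, so a weight of at most
    \<open>3 / 16 * n\<close> excludes it.\<close>
  define w where "w = (\<lambda>f. real n * of_bool (arcless_pair n d m f)
    + real (card (short_cycle_verts n d g f)) + real (card (?H f)))"
  have finF: "finite ?F" by (intro finite_PiE) auto
  have cardF: "card ?F = n ^ (n * d)" by (simp add: card_PiE card_cartesian_product)
  have "?F \<noteq> {}" using cardF assms(1) by (metis card.empty power_not_zero not_gr0)
  have "(\<Sum>f\<in>?F. w f) = real n * real (card {f \<in> ?F. arcless_pair n d m f})
    + real (\<Sum>f\<in>?F. card (short_cycle_verts n d g f)) + real (\<Sum>f\<in>?F. card (?H f))"
    using finF by (simp add: w_def sum.distrib Int_def flip: sum_distrib_left)
  also have "\<dots> \<le> real n * (?N * (1 / 16)) + ?N * (real n / 16) + ?N * (real n / 16)"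
  proof (intro add_mono mult_left_mono)
    have "(1 / 4 :: real) ^ m \<le> (1 / 4) ^ 2" using m by (intro power_decreasing) auto
    hence "(real (n choose m))\<^sup>2 * (real (n - m) / real n) ^ (m * d) \<le> 1 / 16"
      using arcless_pair_probability_le[OF assms(1-5)] by (simp add: power2_eq_square)
    hence "?N * ((real (n choose m))\<^sup>2 * (real (n - m) / real n) ^ (m * d)) \<le> ?N * (1 / 16)"
      by (intro mult_left_mono) auto
    thus "real (card {f \<in> ?F. arcless_pair n d m f}) \<le> ?N * (1 / 16)"
      using card_arcless_pair_functions[OF assms(1), of d m] by linarith
    have "?N * (\<Sum>k<g. (2 * real d) ^ k) \<le> ?N * (real n / 16)"
      using n by (intro mult_left_mono) auto
    thus "real (\<Sum>f\<in>?F. card (short_cycle_verts n d g f)) \<le> ?N * (real n / 16)"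
      using sum_card_short_cycle_verts[OF assms(1), of d g] by linarith
    have "real n * real d / t\<^sup>2 \<le> real n / 16"
      using t assms(1) by (simp add: field_simps)
    hence "?N * (real n * real d / t\<^sup>2) \<le> ?N * (real n / 16)" by (intro mult_left_mono) auto
    thus "real (\<Sum>f\<in>?F. card (?H f)) \<le> ?N * (real n / 16)"
      using sum_card_large_fibres[OF assms(1) t(1), of d] by linarith
  qed auto
  also have "\<dots> = real (card ?F) * (3 / 16 * real n)" by (simp add: cardF)
  finally obtain f where f: "f \<in> ?F" "w f \<le> 3 / 16 * real n"
    using exists_le_average[OF finF \<open>?F \<noteq> {}\<close>] by blast
  have no_pair: "\<not> arcless_pair n d m f"
    using f(2) assms(1) by (cases "arcless_pair n d m f") (auto simp: w_def)
  moreover have "real (card (short_cycle_verts n d g f)) + real (card (?H f)) \<le> 3 / 16 * real n"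
    using f(2) no_pair by (simp add: w_def)
  ultimately show ?thesis using that by blast
qed

lemma finite_short_cycle_verts: "finite (short_cycle_verts n d g f)"
  by (simp add: short_cycle_verts_def cycle_codes_bound)

section \<open>Choice of parameters and deletion\<close>

lemma exists_sparse_digraph:
  fixes \<Delta> g :: nat
  assumes \<Delta>: "160 \<le> \<Delta>" and d: "d = 2 * \<Delta> div 5" and ln_d: "ln (real d) \<ge> exp 1"
  shows "\<exists>D :: (nat, nat \<times> nat) pre_digraph. digraph D \<and> girth D \<ge> enat g \<and>
    max_total_degree D \<le> \<Delta> \<and> real (chromatic_number D) \<ge> (1 / 15) * real \<Delta> / ln (real \<Delta>)"
proof -
  define \<beta> where "\<beta> = 2 * ln (real d) / real d"
  define L where "L = ln (real d)"
  have d_bounds: "5 * d \<le> 2 * \<Delta>" "2 * \<Delta> \<le> 5 * d + 4" "0 < d" using d \<Delta> by auto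
  have Lpos: "L > 0" using less_le_trans[OF exp_gt_zero ln_d] by (simp add: L_def)
  hence \<beta>: "\<beta> > 0" using d_bounds by (simp add: \<beta>_def L_def)
  \<comment> \<open>The term \<open>20 / \<beta>\<close> keeps the rounding in \<open>m\<close>
    below a twentieth of \<open>\<beta> * n\<close>, so that \<open>2 * m\<close> is at most
    \<open>21 / 10 * \<beta> * n\<close>.\<close>
  obtain n where n: "real n \<ge> max 1 (max (20 / \<beta>) (16 * (\<Sum>k<g. (2 * real d) ^ k)))"
    using real_arch_simple by blast
  hence npos: "n > 0" by auto
  have \<beta>n: "20 \<le> \<beta> * real n" using n \<beta> by (simp add: field_simps)
  define m where "m = nat \<lceil>\<beta> * real n\<rceil>"
  have m: "\<beta> * real n \<le> real m" "real m \<le> \<beta> * real n + 1" using \<beta>n by (auto simp: m_def)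
  have m2: "2 \<le> m" using m \<beta>n by linarith
  \<comment> \<open>Out-degree \<open>d\<close> and in-degree below \<open>d + t\<close> add up to
    at most \<Delta>, since \<open>d\<close> is at most two fifths of \<Delta>.\<close>
  define t where "t = real \<Delta> / 5"
  have t: "t > 0" using \<Delta> by (simp add: t_def)
  have "16 * real d \<le> 16 * (2 * real \<Delta> / 5)" using d_bounds by simp
  \<comment> \<open>This inequality is equivalent to \<open>\<Delta> \<ge> 160\<close>, the source
    of that threshold.\<close>
  also have "\<dots> \<le> t\<^sup>2" using \<Delta> by (simp add: t_def power2_eq_square field_simps)
  finally have t2: "16 * real d \<le> t\<^sup>2" .
  let ?H = "\<lambda>f. {v \<in> {..<n}. real d + t \<le> real (card {p \<in> {..<n} \<times> {..<d}. f p = v})}"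
  obtain f where f: "\<not> arcless_pair n d m f"
    "real (card (short_cycle_verts n d g f)) + real (card (?H f)) \<le> 3 / 16 * real n"
    using exists_good_function[of n m d t g] npos m2 d_bounds(3) ln_d m(1) t t2 n
    unfolding \<beta>_def by auto
  define W where "W = {..<n} - (short_cycle_verts n d g f \<union> ?H f)"
  let ?D = "function_digraph f d W"
  have W: "W \<subseteq> {..<n}" "finite W" by (auto simp: W_def)
  have "card {..<n} - card (short_cycle_verts n d g f \<union> ?H f) \<le> card W"
    unfolding W_def by (rule diff_card_le_card_Diff) (simp add: finite_short_cycle_verts)
  hence "real n \<le> real (card W) + (real (card (short_cycle_verts n d g f)) + real (card (?H f)))"
    using card_Un_le[of "short_cycle_verts n d g f" "?H f"] by simp
  hence cardW: "13 / 16 * real n \<le> real (card W)" using f(2) by simp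
  have dig: "digraph ?D" by (rule digraph_function_digraph[OF W(2)])
  moreover have "girth ?D \<ge> enat g"
  proof (rule girth_ge)
    fix vs es assume "underlying_cycle ?D vs es"
    thus "g \<le> length es"
      using underlying_cycle_meets_short_cycle_verts[of f d W vs es g n] W by (force simp: W_def)
  qed
  moreover have "max_total_degree ?D \<le> \<Delta>"
  proof (rule max_total_degree_le)
    fix v assume "v \<in> verts ?D"
    hence "real (card {p \<in> {..<n} \<times> {..<d}. f p = v}) < real d + t" by (auto simp: W_def)
    moreover have "2 * real d + t \<le> real \<Delta>" using d_bounds by (simp add: t_def)
    ultimately show "total_degree ?D v \<le> \<Delta>"
      using total_degree_function_digraph_le[OF W(1), of f d v] by linarith
  qed (simp add: W)
  moreover have "(1 / 15) * real \<Delta> / ln (real \<Delta>) \<le> real (chromatic_number ?D)"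
  proof -
    have "card A \<le> 2 * m" if acyc: "acyclic_set ?D A" for A
    proof (rule ccontr)
      assume "\<not> card A \<le> 2 * m"
      hence "2 * m \<le> card A" by simp
      with W(2) acyc show False
      proof (rule acyclic_set_function_digraph_split)
        fix X Y assume "X \<subseteq> W" "Y \<subseteq> W" "card X = m" "card Y = m"
          "\<And>v i. v \<in> X \<Longrightarrow> i < d \<Longrightarrow> f (v, i) \<notin> Y"
        hence "arcless_pair n d m f"
          using W(1) unfolding arcless_pair_def by (intro exI[of _ X] exI[of _ Y]) auto
        thus False using f(1) by contradiction
      qed
    qed
    hence "card W \<le> chromatic_number ?D * (2 * m)"
      using card_le_chromatic_number[of ?D "2 * m"] W dig by (auto simp: digraph_def)
    hence "real (card W) \<le> real (chromatic_number ?D) * (2 * real m)"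
      using of_nat_mono[where 'a = real] by fastforce
    hence "13 / 16 * real n \<le> real (chromatic_number ?D) * (2 * real m)"
      using cardW by linarith
    also have "\<dots> \<le> real (chromatic_number ?D) * (21 / 10 * \<beta> * real n)"
      using m \<beta>n by (intro mult_left_mono) auto
    finally have "13 / 16 \<le> real (chromatic_number ?D) * (21 / 10 * \<beta>)"
      using npos by (simp add: field_simps)
    hence *: "13 / 16 * real d \<le> real (chromatic_number ?D) * (21 / 5 * L)"
      using d_bounds(3) by (simp add: \<beta>_def L_def field_simps)
    have "L \<le> ln (real \<Delta>)" using d_bounds by (simp add: L_def)
    have "(1 / 15) * real \<Delta> / ln (real \<Delta>) \<le> (1 / 15) * real \<Delta> / L"
      using \<open>L \<le> ln (real \<Delta>)\<close> Lpos by (intro divide_left_mono) auto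
    also have "\<dots> \<le> real (chromatic_number ?D)"
    proof -
      \<comment> \<open>Up to rounding of \<open>d\<close> the right side is
        \<open>13 / 168 * \<Delta>\<close>; as \<open>13 / 168 > 1 / 15\<close>, a large \<Delta>
        absorbs the rounding.\<close>
      have "(1 / 15) * real \<Delta> \<le> 13 / 16 * real d * (5 / 21)" using d_bounds(2) \<Delta> by simp
      also have "\<dots> \<le> real (chromatic_number ?D) * L" using * by simp
      finally show ?thesis using Lpos by (simp add: field_simps)
    qed
    finally show ?thesis .
  qed
  ultimately show ?thesis by blast
qed

text \<open>A single vertex settles the small values of \<Delta>, for which the constant
  \<open>a\<close> is chosen so that the required bound is at most 1.\<close>

lemma exists_trivial_digraph:
  "\<exists>D :: (nat, nat \<times> nat) pre_digraph. digraph D \<and> girth D \<ge> enat g \<and>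
    max_total_degree D \<le> \<Delta> \<and> chromatic_number D \<ge> 1"
proof (intro exI conjI)
  let ?D = "function_digraph (\<lambda>_. 0) 0 {0}"
  have arcs: "arcs ?D = {}" by (simp add: function_digraph_def)
  show dig: "digraph ?D" by (rule digraph_function_digraph) simp
  show "girth ?D \<ge> enat g" by (rule girth_ge) (auto simp: underlying_cycle_def arcs)
  show "max_total_degree ?D \<le> \<Delta>"
    by (rule max_total_degree_le) (auto simp: total_degree_def arcs)
  have "card A \<le> 1" if "acyclic_set ?D A" for A
    using card_mono[of "{0}" A] that by (simp add: acyclic_set_def)
  thus "chromatic_number ?D \<ge> 1"
    using card_le_chromatic_number[of ?D 1] dig by (auto simp: digraph_def)
qed

theorem theorem1:
  shows "(\<exists>a::real. a > 0 \<and>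
            (\<forall>(g::nat) (\<Delta>::nat). g \<ge> 1 \<longrightarrow> \<Delta> \<ge> 2 \<longrightarrow>
               (\<exists>D :: (nat, nat \<times> nat) pre_digraph.
                  digraph D \<and> girth D \<ge> enat g \<and> max_total_degree D \<le> \<Delta> \<and>
                  real (chromatic_number D) \<ge> a * real \<Delta> / ln (real \<Delta>))))
         \<and>
         (\<exists>\<Delta>\<^sub>0::nat. \<forall>(g::nat) (\<Delta>::nat). g \<ge> 1 \<longrightarrow> \<Delta> \<ge> 2 \<longrightarrow> \<Delta> \<ge> \<Delta>\<^sub>0 \<longrightarrow>
               (\<exists>D :: (nat, nat \<times> nat) pre_digraph.
                  digraph D \<and> girth D \<ge> enat g \<and> max_total_degree D \<le> \<Delta> \<and>
                  real (chromatic_number D) \<ge> (1 / 15) * real \<Delta> / ln (real \<Delta>)))"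
proof -
  obtain K :: nat where K: "exp (exp 1) \<le> real K" using real_arch_simple by blast
  \<comment> \<open>The part \<open>5 * K\<close> ensures
    \<open>d \<ge> K \<ge> exp (exp 1)\<close>, that is \<open>ln d \<ge> exp 1\<close>.\<close>
  define \<Delta>\<^sub>0 where "\<Delta>\<^sub>0 = max 160 (5 * K)"
  have large: "\<exists>D :: (nat, nat \<times> nat) pre_digraph. digraph D \<and> girth D \<ge> enat g \<and>
    max_total_degree D \<le> \<Delta> \<and> real (chromatic_number D) \<ge> (1 / 15) * real \<Delta> / ln (real \<Delta>)"
    if "\<Delta> \<ge> \<Delta>\<^sub>0" for g \<Delta> :: nat
  proof (rule exists_sparse_digraph[OF _ refl])
    have "K \<le> 2 * \<Delta> div 5" using that unfolding \<Delta>\<^sub>0_def by linarith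
    hence "exp (exp 1) \<le> real (2 * \<Delta> div 5)" using K by linarith
    moreover from this have "0 < real (2 * \<Delta> div 5)" by (rule less_le_trans[OF exp_gt_zero])
    ultimately show "exp 1 \<le> ln (real (2 * \<Delta> div 5))" by (subst ln_ge_iff)
  qed (use that in \<open>simp add: \<Delta>\<^sub>0_def\<close>)
  \<comment> \<open>Below \<open>\<Delta>\<^sub>0\<close> the second term gives
    \<open>a * \<Delta> \<le> ln 2 \<le> ln \<Delta>\<close>, so one colour meets the bound.\<close>
  define a where "a = min (1 / 15) (ln 2 / real \<Delta>\<^sub>0)"
  have "\<Delta>\<^sub>0 > 0" by (simp add: \<Delta>\<^sub>0_def)
  hence "a > 0" by (simp add: a_def)
  have a_le: "a \<le> 1 / 15" "a \<le> ln 2 / real \<Delta>\<^sub>0"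
    unfolding a_def by (rule min.cobounded1 min.cobounded2)+
  have "\<exists>D :: (nat, nat \<times> nat) pre_digraph. digraph D \<and> girth D \<ge> enat g \<and>
    max_total_degree D \<le> \<Delta> \<and> real (chromatic_number D) \<ge> a * real \<Delta> / ln (real \<Delta>)"
    if "\<Delta> \<ge> 2" for g \<Delta> :: nat
  proof (cases "\<Delta> \<ge> \<Delta>\<^sub>0")
    case True
    have "a * real \<Delta> / ln (real \<Delta>) \<le> (1 / 15) * real \<Delta> / ln (real \<Delta>)"
      using that by (intro divide_right_mono mult_right_mono a_le) auto
    with large[OF True, of g] show ?thesis
      by (elim ex_forward conj_forward) (assumption | linarith)+
  next
    case False
    have "a * real \<Delta> \<le> ln 2 / real \<Delta>\<^sub>0 * real \<Delta>\<^sub>0"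
      using False by (intro mult_mono a_le) auto
    also have "\<dots> = ln 2" using \<open>\<Delta>\<^sub>0 > 0\<close> by simp
    also have "\<dots> \<le> ln (real \<Delta>)" using that by simp
    finally have *: "a * real \<Delta> / ln (real \<Delta>) \<le> 1" using that by (simp add: divide_le_eq_1)
    from exists_trivial_digraph[of g \<Delta>] show ?thesis
    proof (elim ex_forward conj_forward)
      fix D :: "(nat, nat \<times> nat) pre_digraph"
      assume "1 \<le> chromatic_number D"
      thus "a * real \<Delta> / ln (real \<Delta>) \<le> real (chromatic_number D)" using * by linarith
    qed
  qed
  thus ?thesis
    using \<open>a > 0\<close> large by (intro conjI exI[of _ a] exI[of _ \<Delta>\<^sub>0] allI impI) simp_all
qed

end
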